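(* Let $G$ be a connected graph and let $n\ge 2$ be an integer. Then $\dim_{ms}(G\boxtimes K_n)<\infty$ if and only if $n=2$ and $G$ is a multiset distance irregular graph.
   Context: All graphs are finite, simple, undirected and connected; $K_n$ is the complete graph on $n$ vertices. The strong product $G\boxtimes H$ has vertex set $V(G)\times V(H)$, with $(g,h)$ and $(g',h')$ adjacent iff ($g=g'$ and $hh'\in E(H)$) or ($gg'\in E(G)$ and $h=h'$) or ($gg'\in E(G)$ and $hh'\in E(H)$). For a connected graph $G$ with distance $d_G$, $u\in V(G)$ and $W=\{w_1,\dots,w_t\}\subseteq V(G)$, $\mathrm{m}_G(u|W)=\{\!\{d_G(u,w_1),\dots,d_G(u,w_t)\}\!\}$ (a multiset). $W$ is a multiset resolving set if the multisets $\mathrm{m}_G(u|W)$, $u\in V(G)$, are pairwise distinct; $\dim_{ms}(G)$ is the minimum cardinality of a multiset resolving set, and $\dim_{ms}(G)=\infty$ if none exists. $G$ is multiset distance irregular if $\mathrm{m}_G(x|V(G))\ne \mathrm{m}_G(y|V(G))$ for any two distinct vertices $x,y\in V(G)$. *)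

theory Defs
  imports "Graph_Theory.Graph_Theory" "HOL-Library.Multiset" "HOL-Library.Extended_Nat"
begin

text \<open>
  A finite simple undirected graph is a \<^locale>\<open>pair_graph\<close>: each edge is a pair of
  opposite arcs.
\<close>

definition strong_product ::
    "'a pair_pre_digraph \<Rightarrow> 'b pair_pre_digraph \<Rightarrow> ('a \<times> 'b) pair_pre_digraph"
    (infixl \<open>\<boxtimes>\<close> 70) where
  "G \<boxtimes> H = \<lparr> pverts = pverts G \<times> pverts H,
     parcs = {((g, h), (g', h')) | g h g' h'.
       g \<in> pverts G \<and> g' \<in> pverts G \<and> h \<in> pverts H \<and> h' \<in> pverts H \<and>
       (g = g' \<and> (h, h') \<in> parcs H \<or>
        (g, g') \<in> parcs G \<and> h = h' \<or>
        (g, g') \<in> parcs G \<and> (h, h') \<in> parcs H)} \<rparr>"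

text \<open>With unit weights, the cost of a walk is its number of arcs.\<close>

definition graph_dist :: "'a pair_pre_digraph \<Rightarrow> 'a \<Rightarrow> 'a \<Rightarrow> ereal" where
  "graph_dist G u v = wf_digraph.\<mu> (with_proj G) (\<lambda>_. 1) u v"

definition multiset_repr :: "'a pair_pre_digraph \<Rightarrow> 'a \<Rightarrow> 'a set \<Rightarrow> ereal multiset" where
  "multiset_repr G u W = image_mset (graph_dist G u) (mset_set W)"

definition multiset_resolving_set :: "'a pair_pre_digraph \<Rightarrow> 'a set \<Rightarrow> bool" where
  "multiset_resolving_set G W \<longleftrightarrow>
     W \<subseteq> pverts G \<and> inj_on (\<lambda>u. multiset_repr G u W) (pverts G)"

text \<open>The infimum of the empty set of extended naturals is \<open>\<infinity>\<close>.\<close>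

definition dim_ms :: "'a pair_pre_digraph \<Rightarrow> enat" where
  "dim_ms G = (INF W \<in> {W. multiset_resolving_set G W}. enat (card W))"

definition multiset_distance_irregular :: "'a pair_pre_digraph \<Rightarrow> bool" where
  "multiset_distance_irregular G \<longleftrightarrow>
     (\<forall>x \<in> pverts G. \<forall>y \<in> pverts G. x \<noteq> y \<longrightarrow>
        multiset_repr G x (pverts G) \<noteq> multiset_repr G y (pverts G))"

lemma pair_graph_strong_product:
  assumes "pair_graph G" "pair_graph H"
  shows "pair_graph (G \<boxtimes> H)"
proof -
  interpret G: pair_graph G by fact
  interpret H: pair_graph H by fact
  have fin: "finite (pverts (G \<boxtimes> H))"
    by (simp add: strong_product_def G.pair_finite_verts H.pair_finite_verts)
  have sub: "parcs (G \<boxtimes> H) \<subseteq> pverts (G \<boxtimes> H) \<times> pverts (G \<boxtimes> H)"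
    by (auto simp: strong_product_def)
  have sym: "sym (parcs (G \<boxtimes> H))"
    by (auto simp: strong_product_def sym_def intro: G.arcs_symmetric H.arcs_symmetric)
  show ?thesis
  proof unfold_locales
    show "finite (parcs (G \<boxtimes> H))"
      using fin sub by (blast intro: finite_subset)
    show "symmetric (with_proj (G \<boxtimes> H))"
      using sym by (simp add: symmetric_def)
  qed (use fin sub in \<open>auto simp: strong_product_def dest: G.no_loops' H.no_loops'\<close>)
qed

end

theory Submission
  imports Defs
begin

text \<open>
  Two vertices in the same fibre \<open>{g} \<times> V(K)\<close> are true twins, so swapping them preserves all
  distances; hence a multiset resolving set contains exactly one of any two such vertices, which
  forces \<open>n = 2\<close> and makes the set a section \<open>g \<mapsto> (g, s g)\<close>. Seen from \<open>(g, s g)\<close>, its distance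
  multiset is the one of \<open>g\<close> in \<open>G\<close>, and the multiset seen from the twin has \<open>1\<close> in place of
  \<open>0\<close>. So such a section can only resolve if \<open>G\<close> is irregular, and then a constant section does.
\<close>

section \<open>Distances\<close>

text \<open>Relational powers keep only endpoints and length of a walk, which is all that projecting
  to and lifting from a product needs. Taking \<open>u\<close> in \<open>pverts G\<close> matters at
  \<open>k = 0\<close>: the empty walk must start at a vertex, while \<open>parcs G ^^ 0\<close>
  relates everything to itself.\<close>

lemma ex_awalk_iff_relpow:
  assumes "pair_graph G" "u \<in> pverts G"
  shows "(\<exists>p. pre_digraph.awalk (with_proj G) u p v \<and> length p = k) \<longleftrightarrow> (u, v) \<in> parcs G ^^ k"
  using assms(2)
proof (induction k arbitrary: u)
  case 0
  then show ?case
    by (auto simp: pre_digraph.awalk_def pre_digraph.cas.simps)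
next
  case (Suc k)
  interpret G: pair_graph G by fact
  have "(\<exists>p. G.awalk u p v \<and> length p = Suc k) \<longleftrightarrow>
        (\<exists>e p. G.awalk u (e # p) v \<and> length p = k)"
    by (metis Suc_length_conv)
  also have "\<dots> \<longleftrightarrow> (\<exists>w. (u, w) \<in> parcs G \<and> (\<exists>p. G.awalk w p v \<and> length p = k))"
    unfolding G.awalk_Cons_iff by auto
  also have "\<dots> \<longleftrightarrow> (\<exists>w. (u, w) \<in> parcs G \<and> (w, v) \<in> parcs G ^^ k)"
    using Suc.IH G.in_arcsD2 by blast
  also have "\<dots> \<longleftrightarrow> (u, v) \<in> parcs G ^^ Suc k"
    by (meson relpow_Suc_D2 relpow_Suc_I2)
  finally show ?case .
qed

lemma graph_dist_eq_INF_relpow: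
  assumes "pair_graph G" "u \<in> pverts G"
  shows "graph_dist G u v = (INF k \<in> {k. (u, v) \<in> parcs G ^^ k}. ereal (real k))"
proof -
  interpret G: pair_graph G by fact
  have "G.awalk_cost (\<lambda>_. 1) p = real (length p)" for p
    by (induction p) auto
  then have "graph_dist G u v = (INF p \<in> {p. G.awalk u p v}. ereal (real (length p)))"
    by (simp add: graph_dist_def G.\<mu>_def)
  also have "\<dots> = (INF k \<in> length ` {p. G.awalk u p v}. ereal (real k))"
    by (simp add: image_image)
  also have "length ` {p. G.awalk u p v} = {k. (u, v) \<in> parcs G ^^ k}"
    unfolding ex_awalk_iff_relpow[OF assms, symmetric] by auto
  finally show ?thesis .
qed

lemma graph_dist_refl [simp]:
  assumes "pair_graph G" "u \<in> pverts G"
  shows "graph_dist G u u = 0"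
proof (rule antisym)
  show "graph_dist G u u \<le> 0"
    unfolding graph_dist_eq_INF_relpow[OF assms] by (rule INF_lower2[of 0]) auto
  show "0 \<le> graph_dist G u u"
    unfolding graph_dist_eq_INF_relpow[OF assms] by (rule INF_greatest) auto
qed

lemma graph_dist_ge_1:
  assumes "pair_graph G" "u \<in> pverts G" "u \<noteq> v"
  shows "1 \<le> graph_dist G u v"
  unfolding graph_dist_eq_INF_relpow[OF assms(1,2)]
proof (rule INF_greatest)
  fix k assume "k \<in> {k. (u, v) \<in> parcs G ^^ k}"
  then show "1 \<le> ereal (real k)"
    using assms(3) by (cases k) auto
qed

lemma graph_dist_adjacent:
  assumes "pair_graph G" "(u, v) \<in> parcs G"
  shows "graph_dist G u v = 1"
proof (rule antisym)
  interpret G: pair_graph G by fact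
  have u: "u \<in> pverts G" and "u \<noteq> v"
    using assms(2) G.in_arcsD1 G.no_loops' by blast+
  then show "1 \<le> graph_dist G u v"
    using assms(1) by (rule graph_dist_ge_1[rotated])
  show "graph_dist G u v \<le> 1"
    unfolding graph_dist_eq_INF_relpow[OF assms(1) u]
    by (rule INF_lower2[of 1]) (use assms(2) in auto)
qed

section \<open>Walks and distances in the strong product\<close>

lemma strong_product_simps [simp]:
  "pverts (G \<boxtimes> H) = pverts G \<times> pverts H"
  "((g, h), (g', h')) \<in> parcs (G \<boxtimes> H) \<longleftrightarrow>
     g \<in> pverts G \<and> g' \<in> pverts G \<and> h \<in> pverts H \<and> h' \<in> pverts H \<and>
     (g = g' \<and> (h, h') \<in> parcs H \<or> (g, g') \<in> parcs G \<and> h = h' \<or>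
      (g, g') \<in> parcs G \<and> (h, h') \<in> parcs H)"
  by (auto simp: strong_product_def)

text \<open>Project the walk to the first coordinate: steps that move only in \<open>H\<close>
  disappear, so the walk in \<open>G\<close> may be shorter.\<close>

lemma relpow_strong_product_fst:
  assumes "(p, q) \<in> parcs (G \<boxtimes> H) ^^ k"
  shows "\<exists>j\<le>k. (fst p, fst q) \<in> parcs G ^^ j"
  using assms
proof (induction k arbitrary: q)
  case 0
  then show ?case by auto
next
  case (Suc k)
  then obtain r where r: "(p, r) \<in> parcs (G \<boxtimes> H) ^^ k" "(r, q) \<in> parcs (G \<boxtimes> H)"
    by auto
  from Suc.IH[OF r(1)] obtain j where j: "j \<le> k" "(fst p, fst r) \<in> parcs G ^^ j"
    by blast
  have "fst r = fst q \<or> (fst r, fst q) \<in> parcs G"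
    using r(2) by (cases r; cases q) auto
  then show ?case
  proof
    assume "fst r = fst q"
    then show ?thesis using j le_SucI by metis
  next
    assume "(fst r, fst q) \<in> parcs G"
    then show ?thesis using j relpow_Suc_I Suc_le_mono by metis
  qed
qed

text \<open>Since any two vertices of \<open>K\<close> are equal or adjacent, the first step can
  already move from \<open>h\<close> to \<open>h'\<close>; the later steps keep \<open>h'\<close>
  fixed. A walk of length 0 has no such first step, hence the exponent \<open>Suc k\<close>.\<close>

lemma relpow_strong_product_complete:
  assumes "pair_graph G" and K: "complete_digraph n (with_proj K)"
    and "(g, g') \<in> parcs G ^^ Suc k" "h \<in> pverts K" "h' \<in> pverts K"
  shows "((g, h), (g', h')) \<in> parcs (G \<boxtimes> K) ^^ Suc k"
  using assms(3)
proof (induction k arbitrary: g')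
  interpret G: pair_graph G by fact
  note ends = G.in_arcsD1 G.in_arcsD2
  {
    case 0
    then show ?case
      using assms(4,5) K ends by (auto simp: complete_digraph_pair_def)
  next
    case (Suc k)
    then obtain x where x: "(g, x) \<in> parcs G ^^ Suc k" "(x, g') \<in> parcs G"
      by (auto elim: relpow_Suc_E)
    have "((x, h'), (g', h')) \<in> parcs (G \<boxtimes> K)"
      using x(2) assms(5) ends by auto
    with Suc.IH[OF x(1)] show ?case
      by (rule relpow_Suc_I)
  }
qed

text \<open>Between different fibres, lifting and projecting walks give the two inequalities. Within
  a fibre, distinct vertices are adjacent.\<close>

lemma graph_dist_strong_product_complete:
  assumes G: "pair_graph G" and K: "complete_digraph n (with_proj K)"
    and V: "g \<in> pverts G" "g' \<in> pverts G" "h \<in> pverts K" "h' \<in> pverts K"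
  shows "graph_dist (G \<boxtimes> K) (g, h) (g', h') =
    (if g \<noteq> g' then graph_dist G g g' else if h = h' then 0 else 1)"
proof -
  have GK: "pair_graph (G \<boxtimes> K)"
    using G pair_graphI_complete[OF K] by (rule pair_graph_strong_product)
  have gh: "(g, h) \<in> pverts (G \<boxtimes> K)"
    using V by simp
  show ?thesis
  proof (cases "g = g'")
    case True
    have "graph_dist (G \<boxtimes> K) (g, h) (g, h') = 1" if "h \<noteq> h'"
    proof (rule graph_dist_adjacent[OF GK])
      have "(h, h') \<in> parcs K"
        using K V that by (simp add: complete_digraph_pair_def)
      then show "((g, h), (g, h')) \<in> parcs (G \<boxtimes> K)"
        using V by simp
    qed
    then show ?thesis
      using True graph_dist_refl[OF GK gh] by auto
  next
    case False
    have "graph_dist (G \<boxtimes> K) (g, h) (g', h') = graph_dist G g g'"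
      unfolding graph_dist_eq_INF_relpow[OF GK gh] graph_dist_eq_INF_relpow[OF G V(1)]
    proof (rule antisym)
      show "(INF k \<in> {k. ((g, h), (g', h')) \<in> parcs (G \<boxtimes> K) ^^ k}. ereal (real k))
          \<le> (INF k \<in> {k. (g, g') \<in> parcs G ^^ k}. ereal (real k))"
      proof (rule INF_superset_mono)
        show "{k. (g, g') \<in> parcs G ^^ k} \<subseteq> {k. ((g, h), (g', h')) \<in> parcs (G \<boxtimes> K) ^^ k}"
        proof
          fix k assume k: "k \<in> {k. (g, g') \<in> parcs G ^^ k}"
          with False obtain j where "k = Suc j"
            by (cases k) auto
          then show "k \<in> {k. ((g, h), (g', h')) \<in> parcs (G \<boxtimes> K) ^^ k}"
            using k relpow_strong_product_complete[OF G K _ V(3,4)] by blast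
        qed
      qed simp
      show "(INF k \<in> {k. (g, g') \<in> parcs G ^^ k}. ereal (real k))
          \<le> (INF k \<in> {k. ((g, h), (g', h')) \<in> parcs (G \<boxtimes> K) ^^ k}. ereal (real k))"
        by (rule INF_mono) (use relpow_strong_product_fst in fastforce)
    qed
    with False show ?thesis by simp
  qed
qed

section \<open>Multiset representations in the strong product\<close>

lemma multiset_repr_twins_eq:
  assumes G: "pair_graph G" and K: "complete_digraph n (with_proj K)"
    and W: "W \<subseteq> pverts (G \<boxtimes> K)"
    and V: "g \<in> pverts G" "h \<in> pverts K" "h' \<in> pverts K"
    and iff: "(g, h) \<in> W \<longleftrightarrow> (g, h') \<in> W"
  shows "multiset_repr (G \<boxtimes> K) (g, h) W = multiset_repr (G \<boxtimes> K) (g, h') W"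
proof -
  \<comment> \<open>The swap maps \<open>W\<close> onto itself because both twins or neither lie in
    it, so the multiset can be reindexed along the swap.\<close>
  let ?t = "transpose (g, h) (g, h')"
  have "?t ` W = W"
    using iff by simp
  moreover have inj: "inj_on ?t W"
    by (rule inj_on_subset[OF inj_transpose]) simp
  ultimately have "image_mset ?t (mset_set W) = mset_set W"
    by (simp add: image_mset_mset_set)
  then have "multiset_repr (G \<boxtimes> K) (g, h') W =
      image_mset (graph_dist (G \<boxtimes> K) (g, h')) (image_mset ?t (mset_set W))"
    by (simp only: multiset_repr_def)
  also have "\<dots> = image_mset (\<lambda>w. graph_dist (G \<boxtimes> K) (g, h') (?t w)) (mset_set W)"
    by (simp only: multiset.map_comp comp_def)
  also have "\<dots> = multiset_repr (G \<boxtimes> K) (g, h) W"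
    unfolding multiset_repr_def
  proof (rule image_mset_cong)
    fix w assume "w \<in># mset_set W"
    \<comment> \<open>For infinite \<open>W\<close>, \<open>mset_set W\<close> would be empty, so
      that case is vacuous.\<close>
    then have "w \<in> W"
      by (cases "finite W") auto
    then obtain x y where w: "w = (x, y)" "x \<in> pverts G" "y \<in> pverts K"
      using W by auto
    show "graph_dist (G \<boxtimes> K) (g, h') (?t w) = graph_dist (G \<boxtimes> K) (g, h) w"
      using w V by (auto simp: transpose_def graph_dist_strong_product_complete[OF G K])
  qed
  finally show ?thesis by simp
qed

text \<open>A fibre over \<open>x\<close> other than \<open>g\<close> contributes
  \<open>graph_dist G g x\<close>, whatever \<open>s x\<close> is. Only the fibre of
  \<open>g\<close> sees \<open>h\<close>, with entry 0 or 1. The removal of 0 is genuine, because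
  \<open>g\<close> contributes a 0 to its own multiset in \<open>G\<close>.\<close>

lemma multiset_repr_section:
  assumes G: "pair_graph G" and K: "complete_digraph n (with_proj K)"
    and s: "\<And>x. x \<in> pverts G \<Longrightarrow> s x \<in> pverts K"
    and V: "g \<in> pverts G" "h \<in> pverts K"
  defines "W \<equiv> (\<lambda>x. (x, s x)) ` pverts G"
  shows "multiset_repr (G \<boxtimes> K) (g, h) W =
    (if h = s g then multiset_repr G g (pverts G)
     else multiset_repr G g (pverts G) - {#0#} + {#1#})"
proof -
  interpret G: pair_graph G by fact
  let ?M = "mset_set (pverts G - {g})"
  have fin: "finite (pverts G)"
    by (rule G.pair_finite_verts)
  have M: "mset_set (pverts G) = add_mset g ?M"
    using fin V(1) by (rule mset_set.remove)
  have "mset_set W = image_mset (\<lambda>x. (x, s x)) (mset_set (pverts G))"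
    unfolding W_def by (rule image_mset_mset_set[symmetric]) (auto intro: inj_onI)
  then have "multiset_repr (G \<boxtimes> K) (g, h) W =
      add_mset (graph_dist (G \<boxtimes> K) (g, h) (g, s g))
        (image_mset (\<lambda>x. graph_dist (G \<boxtimes> K) (g, h) (x, s x)) ?M)"
    by (simp add: multiset_repr_def M multiset.map_comp comp_def)
  also have "image_mset (\<lambda>x. graph_dist (G \<boxtimes> K) (g, h) (x, s x)) ?M =
      image_mset (graph_dist G g) ?M"
    by (rule image_mset_cong)
      (use fin s V in \<open>auto simp: graph_dist_strong_product_complete[OF G K]\<close>)
  also have "graph_dist (G \<boxtimes> K) (g, h) (g, s g) = (if h = s g then 0 else 1)"
    using s V by (simp add: graph_dist_strong_product_complete[OF G K])
  finally show ?thesis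
    using G V by (simp add: multiset_repr_def M)
qed

lemma multiset_resolving_set_fibre:
  assumes G: "pair_graph G" and K: "complete_digraph n (with_proj K)"
    and W: "multiset_resolving_set (G \<boxtimes> K) W"
    and V: "g \<in> pverts G" "h \<in> pverts K" "h' \<in> pverts K" "h \<noteq> h'"
  shows "(g, h) \<in> W \<longleftrightarrow> (g, h') \<notin> W"
proof (rule ccontr)
  assume "\<not> ?thesis"
  then have "multiset_repr (G \<boxtimes> K) (g, h) W = multiset_repr (G \<boxtimes> K) (g, h') W"
    using W by (intro multiset_repr_twins_eq[OF G K _ V(1-3)])
      (auto simp: multiset_resolving_set_def)
  then show False
    using W V unfolding multiset_resolving_set_def by (auto dest: inj_onD)
qed

text \<open>Every \<open>enat (card W)\<close> lies below \<infinity>, so the infimum does so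
  exactly when its index set is nonempty.\<close>

lemma dim_ms_finite_iff: "dim_ms G < \<infinity> \<longleftrightarrow> (\<exists>W. multiset_resolving_set G W)"
proof -
  have "dim_ms G < \<infinity> \<longleftrightarrow> (\<exists>W \<in> {W. multiset_resolving_set G W}. enat (card W) < \<infinity>)"
    unfolding dim_ms_def by (rule INF_less_iff)
  then show ?thesis by simp
qed

theorem theorem7:
  fixes G :: "'a pair_pre_digraph" and K :: "'b pair_pre_digraph" and n :: nat
  assumes "pair_graph G"
    and "Digraph_Component.connected (with_proj G)"
    and "n \<ge> 2"
    and "complete_digraph n (with_proj K)"
  shows "dim_ms (G \<boxtimes> K) < \<infinity> \<longleftrightarrow> n = 2 \<and> multiset_distance_irregular G"
proof -
  note G = assms(1) and K = assms(4)
  have cardK: "card (pverts K) = n"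
    using K by (simp add: complete_digraph_pair_def)
  show ?thesis
    unfolding dim_ms_finite_iff
  proof
    assume "\<exists>W. multiset_resolving_set (G \<boxtimes> K) W"
    then obtain W where W: "multiset_resolving_set (G \<boxtimes> K) W" ..
    note fibre = multiset_resolving_set_fibre[OF G K W]
    \<comment> \<open>Connectedness includes having a vertex; its fibre is where \<open>n\<close>
      gets bounded.\<close>
    obtain g where g: "g \<in> pverts G"
      using assms(2)
      by (auto simp: Digraph_Component.connected_def strongly_connected_def mk_symmetric_def)
    have n: "n = 2"
    proof (rule ccontr)
      assume "n \<noteq> 2"
      then have "3 \<le> card (pverts K)"
        using cardK assms(3) by simp
      then obtain T where "T \<subseteq> pverts K" "card T = 3"
        by (metis obtain_subset_with_card_n)
      \<comment> \<open>By pigeonhole, two of three vertices in the fibre are both in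
        \<open>W\<close> or both outside it, against \<open>fibre\<close>.\<close>
      then obtain a b c where "a \<in> pverts K" "b \<in> pverts K" "c \<in> pverts K"
        "a \<noteq> b" "b \<noteq> c" "a \<noteq> c"
        by (auto simp: card_3_iff)
      then show False
        using fibre[OF g] by blast
    qed
    then obtain a b where ab: "pverts K = {a, b}" "a \<noteq> b"
      using cardK by (auto simp: card_2_iff)
    \<comment> \<open>\<open>s x\<close> selects the element of \<open>W\<close> over
      \<open>x\<close>: if \<open>(x, a)\<close> is not in \<open>W\<close>, then
      \<open>fibre\<close> puts \<open>(x, b)\<close> there.\<close>
    define s where "s x = (if (x, a) \<in> W then a else b)" for x
    have s: "s x \<in> pverts K" for x
      by (simp add: s_def ab)
    have "W \<subseteq> pverts G \<times> pverts K"
      using W by (simp add: multiset_resolving_set_def)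
    then have W_eq: "W = (\<lambda>x. (x, s x)) ` pverts G"
      using fibre[of _ a b] ab by (auto simp: s_def image_iff)
    have "multiset_distance_irregular G"
      unfolding multiset_distance_irregular_def
    proof (intro ballI impI notI)
      fix x y
      assume xy: "x \<in> pverts G" "y \<in> pverts G" "x \<noteq> y"
        and "multiset_repr G x (pverts G) = multiset_repr G y (pverts G)"
      \<comment> \<open>From the points of the section itself the multisets are those of
        \<open>G\<close>, so a coincidence in \<open>G\<close> carries over to the product.\<close>
      then have "multiset_repr (G \<boxtimes> K) (x, s x) W = multiset_repr (G \<boxtimes> K) (y, s y) W"
        unfolding W_eq using s by (simp add: multiset_repr_section[OF G K])
      then show False
        using W xy s unfolding multiset_resolving_set_def by (auto dest: inj_onD)
    qed
    with n show "n = 2 \<and> multiset_distance_irregular G" ..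
  next
    assume "n = 2 \<and> multiset_distance_irregular G"
    then have irr: "multiset_distance_irregular G" and "card (pverts K) = 2"
      using cardK by auto
    then obtain a b where ab: "pverts K = {a, b}" "a \<noteq> b"
      by (auto simp: card_2_iff)
    interpret G: pair_graph G by fact
    define m where "m x = multiset_repr G x (pverts G)" for x
    \<comment> \<open>\<open>R x\<close> leaves out the distance from \<open>x\<close> to itself. It
      contains no 0, and it still determines \<open>x\<close>, since \<open>m x\<close> is
      \<open>R x\<close> with one 0 added.\<close>
    define R where "R x = image_mset (graph_dist G x) (mset_set (pverts G - {x}))" for x
    have m: "m x = add_mset 0 (R x)" if "x \<in> pverts G" for x
      using that G G.pair_finite_verts
      by (simp add: m_def R_def multiset_repr_def mset_set.remove)
    have R0: "0 \<notin># R x" if "x \<in> pverts G" for x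
      using graph_dist_ge_1[OF G that] G.pair_finite_verts by (fastforce simp: R_def)
    have R_inj: "x = y" if "x \<in> pverts G" "y \<in> pverts G" "R x = R y" for x y
      using irr that m unfolding multiset_distance_irregular_def m_def by metis
    have repr: "multiset_repr (G \<boxtimes> K) (x, h) ((\<lambda>x. (x, a)) ` pverts G) =
        add_mset (if h = a then 0 else 1) (R x)"
      if "x \<in> pverts G" "h \<in> pverts K" for x h
      using multiset_repr_section[OF G K, of "\<lambda>_. a" x h] that m[OF that(1)] ab
      by (auto simp: m_def)
    have "multiset_resolving_set (G \<boxtimes> K) ((\<lambda>x. (x, a)) ` pverts G)"
      unfolding multiset_resolving_set_def
    proof (intro conjI inj_onI)
      show "(\<lambda>x. (x, a)) ` pverts G \<subseteq> pverts (G \<boxtimes> K)"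
        using ab by auto
      fix u v
      assume uv: "u \<in> pverts (G \<boxtimes> K)" "v \<in> pverts (G \<boxtimes> K)"
        and eq: "multiset_repr (G \<boxtimes> K) u ((\<lambda>x. (x, a)) ` pverts G) =
          multiset_repr (G \<boxtimes> K) v ((\<lambda>x. (x, a)) ` pverts G)"
      obtain x h y k where u: "u = (x, h)" "x \<in> pverts G" "h \<in> pverts K"
        and v: "v = (y, k)" "y \<in> pverts G" "k \<in> pverts K"
        using uv by auto
      have eq': "add_mset (if h = a then 0 else 1) (R x) = add_mset (if k = a then 0 else 1) (R y)"
        using eq u v repr by simp
      then have "0 \<in># add_mset (if h = a then 0 else 1) (R x) \<longleftrightarrow>
          0 \<in># add_mset (if k = a then 0 else 1) (R y)"
        by simp
      \<comment> \<open>A 0 in the multiset can only come from the added entry, so its presence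
        reveals whether the vertex lies on the section.\<close>
      then have "h = a \<longleftrightarrow> k = a"
        using R0 u v by (auto split: if_splits)
      \<comment> \<open>The added entries now agree and cancel. As \<open>K\<close> has only the
        vertices \<open>a\<close> and \<open>b\<close>, the equivalence just shown also gives
        \<open>h = k\<close>.\<close>
      moreover from this have "R x = R y"
        using eq' by (auto split: if_splits)
      ultimately show "u = v"
        using R_inj u v ab by auto
    qed
    then show "\<exists>W. multiset_resolving_set (G \<boxtimes> K) W" ..
  qed
qed

end
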